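(* Let $A$ be a 3-dimensional 3-Lie algebra. Then for any $r\in\wedge^2(A)$, $[[r,r,r]]=0$. That is, any $r\in\wedge^2(A)$ is a solution of the 3-Lie classical Yang-Baxter equation $[[r,r,r]]=0$ in a 3-dimensional 3-Lie algebra.
   Context: A 3-Lie algebra is a vector space $A$ with a trilinear, totally skew-symmetric bracket $[\cdot,\cdot,\cdot]:\otimes^3A\to A$ such that for all $x_1,\dots,x_5\in A$: $[x_1,x_2,[x_3,x_4,x_5]]=[[x_1,x_2,x_3],x_4,x_5]+[x_3,[x_1,x_2,x_4],x_5]+[x_3,x_4,[x_1,x_2,x_5]]$. For $r=\sum_i x_i\otimes y_i\in A\otimes A$, the element $[[r,r,r]]\in\otimes^4A$ is $$[[r,r,r]]=\sum_{i,j,k}\big([x_i,x_j,x_k]\otimes y_i\otimes y_j\otimes y_k+x_i\otimes[y_i,x_j,x_k]\otimes y_j\otimes y_k+x_i\otimes x_j\otimes[y_i,y_j,x_k]\otimes y_k+x_i\otimes x_j\otimes x_k\otimes[y_i,y_j,y_k]\big).$$ Here $\wedge^2(A)$ is the second exterior power of $A$, viewed inside $A\otimes A$ as the span of the elements $x\wedge y=x\otimes y-y\otimes x$ with $x,y\in A$. *)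

theory Defs
  imports Complex_Main "HOL-Library.Poly_Mapping"
begin

text \<open>
  The underlying vector space is a whole type, over an arbitrary field. For a trilinear bracket,
  total skew-symmetry is sign change under the transpositions generating the symmetric group
  on the three arguments. The axiom \<open>alternating\<close> follows from it unless the characteristic is 2
  (see \<open>alternating_if_skew\<close> below); in characteristic 2 it is the usual convention.
\<close>

locale three_lie_algebra = vector_space scale
  for scale :: "'k::field \<Rightarrow> 'a::ab_group_add \<Rightarrow> 'a" +
  fixes br :: "'a \<Rightarrow> 'a \<Rightarrow> 'a \<Rightarrow> 'a"
  assumes linear1: "Vector_Spaces.linear scale scale (\<lambda>x. br x y z)"
    and linear2: "Vector_Spaces.linear scale scale (\<lambda>y. br x y z)"
    and linear3: "Vector_Spaces.linear scale scale (\<lambda>z. br x y z)"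
    and skew12: "br y x z = - br x y z"
    and skew23: "br x z y = - br x y z"
    and alternating: "br x x z = 0"
    and fundamental_identity:
      "br x1 x2 (br x3 x4 x5) =
         br (br x1 x2 x3) x4 x5 + br x3 (br x1 x2 x4) x5 + br x3 x4 (br x1 x2 x5)"

lemma alternating_if_skew:
  fixes scale :: "'k::field \<Rightarrow> 'a::ab_group_add \<Rightarrow> 'a"
  assumes "vector_space scale" and "(2::'k) \<noteq> 0"
    and skew: "\<And>x y z. br y x z = - (br x y z :: 'a)"
  shows "br x x z = 0"
proof -
  interpret vector_space scale by fact
  have "br x x z + br x x z = 0"
    using skew[of x x z] by (metis add.right_inverse)
  then have "scale 2 (br x x z) = 0"
    using scale_left_distrib[of 1 1 "br x x z"] by simp
  with assms(2) show ?thesis by simp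
qed

text \<open>
  The tensor power of order \<open>n\<close> is the free vector space on the lists of length \<open>n\<close>,
  realised by finitely supported functions, modulo the multilinearity relations.
  A tensor is a coset, i.e. a set of formal sums.
\<close>

definition formal_scale :: "'k::field \<Rightarrow> ('b \<Rightarrow>\<^sub>0 'k) \<Rightarrow> ('b \<Rightarrow>\<^sub>0 'k)" where
  "formal_scale c f = Poly_Mapping.map ((*) c) f"

lemma lookup_formal_scale: "Poly_Mapping.lookup (formal_scale c f) k = c * Poly_Mapping.lookup f k"
  by (simp add: formal_scale_def Poly_Mapping.map.rep_eq when_def)

lemma vector_space_formal_scale: "vector_space formal_scale"
  by (unfold_locales;
      rule poly_mapping_eqI;
      simp add: lookup_formal_scale lookup_add algebra_simps)

abbreviation pure :: "'a list \<Rightarrow> ('a list \<Rightarrow>\<^sub>0 'k::field)" where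
  "pure xs \<equiv> Poly_Mapping.single xs 1"

definition tensor_relations ::
  "('k::field \<Rightarrow> 'a::ab_group_add \<Rightarrow> 'a) \<Rightarrow> nat \<Rightarrow> ('a list \<Rightarrow>\<^sub>0 'k) set" where
  "tensor_relations scale n =
     {pure (xs[i := x + y]) - pure (xs[i := x]) - pure (xs[i := y]) | xs i x y.
        length xs = n \<and> i < n} \<union>
     {pure (xs[i := scale c x]) - formal_scale c (pure (xs[i := x])) | xs i c x.
        length xs = n \<and> i < n}"

text \<open>
  The tensor denoted by a formal sum of lists of length \<open>n\<close>. Thus the tensor
  $\sum_i x_i \otimes y_i$ is \<open>tensor scale 2 (\<Sum>i<n. pure [x i, y i])\<close>, and the zero of the
  tensor power of order \<open>n\<close> is \<open>tensor scale n 0\<close>.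
\<close>

definition tensor ::
  "('k::field \<Rightarrow> 'a::ab_group_add \<Rightarrow> 'a) \<Rightarrow> nat \<Rightarrow> ('a list \<Rightarrow>\<^sub>0 'k) \<Rightarrow> ('a list \<Rightarrow>\<^sub>0 'k) set" where
  "tensor scale n f = {g. g - f \<in> module.span formal_scale (tensor_relations scale n)}"

lemma tensor_eq_iff:
  "tensor scale n f = tensor scale n g \<longleftrightarrow>
     f - g \<in> module.span formal_scale (tensor_relations scale n)"
proof -
  interpret F: vector_space formal_scale by (rule vector_space_formal_scale)
  show ?thesis
  proof
    assume "tensor scale n f = tensor scale n g"
    moreover have "f \<in> tensor scale n f"
      by (simp add: tensor_def F.span_zero)
    ultimately show "f - g \<in> F.span (tensor_relations scale n)"
      by (auto simp: tensor_def)
  next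
    assume *: "f - g \<in> F.span (tensor_relations scale n)"
    have "h - f \<in> F.span (tensor_relations scale n) \<longleftrightarrow>
          h - g \<in> F.span (tensor_relations scale n)" for h
      using F.span_add[OF _ *, of "h - f"] F.span_diff[OF _ *, of "h - g"] by auto
    then show "tensor scale n f = tensor scale n g"
      by (simp add: tensor_def)
  qed
qed

definition wedge2 ::
  "('k::field \<Rightarrow> 'a::ab_group_add \<Rightarrow> 'a) \<Rightarrow> ('a list \<Rightarrow>\<^sub>0 'k) set set" where
  "wedge2 scale = tensor scale 2 ` module.span formal_scale {pure [x, y] - pure [y, x] | x y. True}"

text \<open>
  The formal sum denoting $[[r,r,r]]$, for $r = \sum_{i<n} x_i \otimes y_i$.
\<close>

definition yang_baxter ::
  "('a \<Rightarrow> 'a \<Rightarrow> 'a \<Rightarrow> 'a) \<Rightarrow> nat \<Rightarrow> (nat \<Rightarrow> 'a) \<Rightarrow> (nat \<Rightarrow> 'a) \<Rightarrow> ('a list \<Rightarrow>\<^sub>0 'k::field)" where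
  "yang_baxter br n x y =
     (\<Sum>i<n. \<Sum>j<n. \<Sum>k<n.
        pure [br (x i) (x j) (x k), y i, y j, y k] +
        pure [x i, br (y i) (x j) (x k), y j, y k] +
        pure [x i, x j, br (y i) (y j) (x k), y k] +
        pure [x i, x j, x k, br (y i) (y j) (y k)])"

end

theory Submission imports Defs begin

text \<open>
  In dimension 3 every element of the second exterior power is decomposable, $r = u \wedge v$.
  Since $[[r,r,r]]$ depends only on the tensor $r$, it may be computed from this representation,
  where each bracket has three arguments from $\{u, v\}$ and therefore vanishes. Tensors are
  compared by evaluating them under all multilinear forms.
\<close>

section \<open>Linear functionals on formal sums and on tensors\<close>

lemma vector_space_field: "vector_space ((*) :: 'k::field \<Rightarrow> 'k \<Rightarrow> 'k)"
  by unfold_locales (simp_all add: algebra_simps)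

lemma linear_at_0:
  assumes "Vector_Spaces.linear s1 s2 f"
  shows "f 0 = 0"
proof -
  interpret Vector_Spaces.linear s1 s2 f by fact
  show ?thesis by (rule zero)
qed

text \<open>If \<open>f\<close> lay outside the span, adjoining it to a maximal independent
  \<open>B \<subseteq> S\<close> would keep independence, so some functional would be 1 at
  \<open>f\<close> and 0 on \<open>B\<close>, hence on \<open>S\<close>. This turns equality of
  tensors into a test by functionals.\<close>

lemma mem_span_if_functionals_vanish:
  fixes s :: "'k::field \<Rightarrow> 'b::ab_group_add \<Rightarrow> 'b"
  assumes "vector_space s"
    and vanish: "\<And>L. Vector_Spaces.linear s (*) L \<Longrightarrow> (\<And>x. x \<in> S \<Longrightarrow> L x = 0) \<Longrightarrow> L f = 0"
  shows "f \<in> module.span s S"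
proof (rule ccontr)
  interpret V: vector_space s by fact
  interpret P: vector_space_pair s "(*) :: 'k \<Rightarrow> 'k \<Rightarrow> 'k"
    by (intro vector_space_pair.intro vector_space_field assms)
  assume f: "f \<notin> V.span S"
  obtain B where B: "B \<subseteq> S" "V.independent B" "S \<subseteq> V.span B"
    using V.maximal_independent_subset[of S] by blast
  have fB: "f \<notin> V.span B"
    using f V.span_mono[OF B(1)] by blast
  then have "V.independent (insert f B)"
    using B(2) by (simp add: V.independent_insert)
  then obtain L where L: "Vector_Spaces.linear s (*) L"
    and LB: "\<And>x. x \<in> insert f B \<Longrightarrow> L x = (if x = f then 1 else 0)"
    using P.linear_independent_extend[of "insert f B" "\<lambda>x. if x = f then 1 else 0"] by blast
  have "L x = 0" if "x \<in> B" for x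
    using LB[of x] that fB V.span_base by auto
  then have "L x = 0" if "x \<in> S" for x
    using P.linear_eq_0_on_span[OF L] B(3) that by blast
  then have "L f = 0"
    using vanish L by blast
  with LB[of f] show False by simp
qed

text \<open>Universal property of the free vector space: the single-point functions form a
  basis.\<close>

lemma formal_linear_extend:
  fixes g :: "'b \<Rightarrow> 'k::field"
  obtains L where "Vector_Spaces.linear formal_scale (*) L"
    and "\<And>b. L (Poly_Mapping.single b 1) = g b"
proof
  let ?L = "\<lambda>f. \<Sum>b\<in>Poly_Mapping.keys f. Poly_Mapping.lookup f b * g b"
  \<comment> \<open>The index set of \<open>?L f\<close> varies with \<open>f\<close>; padding with
    zero terms lets sums for different arguments be compared over one finite set.\<close>
  have on_superset: "?L f = (\<Sum>b\<in>A. Poly_Mapping.lookup f b * g b)"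
    if "finite A" "Poly_Mapping.keys f \<subseteq> A" for f A
    using that by (intro sum.mono_neutral_left) (auto simp: in_keys_iff)
  show "Vector_Spaces.linear formal_scale (*) ?L"
    unfolding Vector_Spaces.linear_iff
  proof (intro conjI allI vector_space_formal_scale vector_space_field)
    fix f h :: "'b \<Rightarrow>\<^sub>0 'k"
    let ?A = "Poly_Mapping.keys f \<union> Poly_Mapping.keys h"
    have "?L (f + h) = (\<Sum>b\<in>?A. Poly_Mapping.lookup (f + h) b * g b)"
      by (rule on_superset) (use Poly_Mapping.keys_add[of f h] in auto)
    also have "\<dots> = (\<Sum>b\<in>?A. Poly_Mapping.lookup f b * g b) +
        (\<Sum>b\<in>?A. Poly_Mapping.lookup h b * g b)"
      by (simp add: lookup_add distrib_right sum.distrib)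
    finally show "?L (f + h) = ?L f + ?L h"
      by (simp add: on_superset[of ?A f] on_superset[of ?A h])
  next
    fix c :: 'k and f :: "'b \<Rightarrow>\<^sub>0 'k"
    have "?L (formal_scale c f) =
        (\<Sum>b\<in>Poly_Mapping.keys f. Poly_Mapping.lookup (formal_scale c f) b * g b)"
      by (rule on_superset) (auto simp: in_keys_iff lookup_formal_scale)
    then show "?L (formal_scale c f) = c * ?L f"
      by (simp add: lookup_formal_scale sum_distrib_left mult.assoc)
  qed
  show "?L (Poly_Mapping.single b 1) = g b" for b
    by simp
qed

text \<open>The two families of relations are exactly additivity and homogeneity in slot
  \<open>i\<close>, so a functional killing them restricts to a multilinear form on lists of length
  \<open>n\<close>.\<close>

lemma linear_pure_update:
  assumes "vector_space scale"
    and L: "Vector_Spaces.linear formal_scale (*) L"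
    and rel: "\<And>t. t \<in> tensor_relations scale n \<Longrightarrow> L t = 0"
    and xs: "length xs = n" "i < n"
  shows "Vector_Spaces.linear scale (*) (\<lambda>x. L (pure (xs[i := x])))"
proof -
  interpret L: Vector_Spaces.linear formal_scale "(*)" L by fact
  show ?thesis
    unfolding Vector_Spaces.linear_iff
  proof (intro conjI allI assms(1) vector_space_field)
    fix x y
    have "pure (xs[i := x + y]) - pure (xs[i := x]) - pure (xs[i := y]) \<in> tensor_relations scale n"
      using xs unfolding tensor_relations_def by blast
    from rel[OF this] show "L (pure (xs[i := x + y])) = L (pure (xs[i := x])) + L (pure (xs[i := y]))"
      by (simp add: L.diff diff_eq_eq add.commute)
  next
    fix c x
    have "pure (xs[i := scale c x]) - formal_scale c (pure (xs[i := x])) \<in> tensor_relations scale n"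
      using xs unfolding tensor_relations_def by blast
    from rel[OF this] show "L (pure (xs[i := scale c x])) = c * L (pure (xs[i := x]))"
      by (simp add: L.diff L.scale)
  qed
qed

section \<open>Bilinear forms as functionals on the tensor square\<close>

definition bilinear_form :: "('k::field \<Rightarrow> 'a::ab_group_add \<Rightarrow> 'a) \<Rightarrow> ('a \<Rightarrow> 'a \<Rightarrow> 'k) \<Rightarrow> bool" where
  "bilinear_form scale G \<longleftrightarrow>
     (\<forall>y. Vector_Spaces.linear scale (*) (\<lambda>x. G x y)) \<and> (\<forall>x. Vector_Spaces.linear scale (*) (G x))"

lemma bilinear_formD:
  assumes "bilinear_form scale G"
  shows "G (x + x') y = G x y + G x' y" "G x (y + y') = G x y + G x y'"
    "G (scale c x) y = c * G x y" "G x (scale c y) = c * G x y"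
proof -
  interpret l: Vector_Spaces.linear scale "(*)" "\<lambda>x. G x y"
    using assms unfolding bilinear_form_def by blast
  interpret r: Vector_Spaces.linear scale "(*)" "G x"
    using assms unfolding bilinear_form_def by blast
  show "G (x + x') y = G x y + G x' y" "G x (y + y') = G x y + G x y'"
    "G (scale c x) y = c * G x y" "G x (scale c y) = c * G x y"
    using l.add l.scale r.add r.scale by blast+
qed

text \<open>Universal property of the tensor square, converse to the passage from functionals to
  multilinear forms.\<close>

lemma bilinear_form_lift:
  fixes scale :: "'k::field \<Rightarrow> 'a::ab_group_add \<Rightarrow> 'a"
  assumes "bilinear_form scale G"
  obtains L where "Vector_Spaces.linear formal_scale (*) L"
    and "\<And>a b. L (pure [a, b]) = G a b"
    and "\<And>t. t \<in> tensor_relations scale 2 \<Longrightarrow> L t = 0"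
proof -
  obtain L :: "('a list \<Rightarrow>\<^sub>0 'k) \<Rightarrow> 'k" where L: "Vector_Spaces.linear formal_scale (*) L"
    and pure: "\<And>b. L (pure b) = G (b ! 0) (b ! 1)"
    \<comment> \<open>On lists shorter than 2 the value is unspecified, which is harmless: the
      relations of order 2 involve only lists of length 2.\<close>
    using formal_linear_extend[of "\<lambda>b. G (b ! 0) (b ! 1)"] by blast
  interpret L: Vector_Spaces.linear formal_scale "(*)" L by fact
  have "L t = 0" if "t \<in> tensor_relations scale 2" for t
    using that unfolding tensor_relations_def
    by (auto simp: L.diff L.scale pure bilinear_formD[OF assms] less_2_cases_iff)
  with L pure show ?thesis by (intro that[of L]) auto
qed

section \<open>Decomposition as u \<and> v in dimension 3, and its use in triple sums\<close>

lemma dim_3_spanning: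
  fixes scale :: "'k::field \<Rightarrow> 'a::ab_group_add \<Rightarrow> 'a"
  assumes "vector_space scale" and dim: "vector_space.dim scale (UNIV :: 'a set) = 3"
  obtains e1 e2 e3 where "\<And>v. \<exists>a b c. v = scale a e1 + scale b e2 + scale c e3"
proof -
  interpret vector_space scale by fact
  obtain B where B: "UNIV \<subseteq> span B" "card B = 3"
    using basis_exists[of UNIV] dim by metis
  then obtain e1 e2 e3 where "B = {e1, e2, e3}"
    by (auto simp: card_3_iff)
  with B(1) have "v \<in> span {e1, e2, e3}" for v by blast
  then have "\<exists>a b c. v - scale a e1 - scale b e2 - scale c e3 = 0" for v
    by (simp add: span_breakdown_eq)
  then have "\<exists>a b c. v = scale a e1 + scale b e2 + scale c e3" for v
    by (simp add: algebra_simps)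
  then show ?thesis by (rule that)
qed

text \<open>
  \<open>e\<^sub>1 \<wedge> (p e\<^sub>2 + q e\<^sub>3) + s e\<^sub>2 \<wedge> e\<^sub>3\<close> equals \<open>(e\<^sub>1 - (s / p) e\<^sub>3) \<wedge> (p e\<^sub>2 + q e\<^sub>3)\<close> if \<open>p \<noteq> 0\<close>, and
  \<open>(q e\<^sub>1 + s e\<^sub>2) \<wedge> e\<^sub>3\<close> otherwise.
\<close>

lemma wedge_decomposable:
  fixes scale :: "'k::field \<Rightarrow> 'a::ab_group_add \<Rightarrow> 'a"
  obtains u v where "\<And>G. bilinear_form scale G \<Longrightarrow>
    p * (G e1 e2 - G e2 e1) + q * (G e1 e3 - G e3 e1) + s * (G e2 e3 - G e3 e2) = G u v - G v u"
proof (cases "p = 0")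
  case True
  show ?thesis
    by (rule that[of "scale q e1 + scale s e2" e3]) (simp add: True bilinear_formD algebra_simps)
next
  case False
  then show ?thesis
    by (intro that[of "e1 + scale (- s / p) e3" "scale p e2 + scale q e3"])
      (simp add: bilinear_formD field_simps)
qed

text \<open>The equality of tensors r = u \<and> v is phrased through bilinear forms, since this is
  how it is applied to triple sums. One pair \<open>u\<close>, \<open>v\<close> serves all
  \<open>G\<close>.\<close>

lemma wedge2_dim_3_decomposable:
  fixes scale :: "'k::field \<Rightarrow> 'a::ab_group_add \<Rightarrow> 'a"
  assumes V: "vector_space scale" and dim: "vector_space.dim scale (UNIV :: 'a set) = 3"
    and mem: "tensor scale 2 (\<Sum>i<n. pure [x i, y i]) \<in> wedge2 scale"
  obtains u v where "\<And>G. bilinear_form scale G \<Longrightarrow> (\<Sum>i<n. G (x i) (y i)) = G u v - G v u"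
proof -
  interpret F: vector_space "formal_scale :: 'k \<Rightarrow> ('a list \<Rightarrow>\<^sub>0 'k) \<Rightarrow> _"
    by (rule vector_space_formal_scale)
  obtain e1 e2 e3 where e: "\<And>v. \<exists>a b c. v = scale a e1 + scale b e2 + scale c e3"
    using dim_3_spanning[OF V dim] by blast
  let ?W = "{pure [x, y] - pure [y, x] | x y. True} :: ('a list \<Rightarrow>\<^sub>0 'k) set"
  \<comment> \<open>\<open>p\<close>, \<open>q\<close>, \<open>s\<close> are coordinates of
    \<open>f\<close> with respect to e1 \<and> e2, e1 \<and> e3, e2 \<and> e3, as seen by
    functionals that are bilinear on pairs. They are fixed before \<open>L\<close>, so they do not
    depend on it.\<close>
  define Q where "Q p q s f \<longleftrightarrow> (\<forall>L. Vector_Spaces.linear formal_scale (*) L \<longrightarrow>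
      bilinear_form scale (\<lambda>a b. L (pure [a, b])) \<longrightarrow>
      L f = p * (L (pure [e1, e2]) - L (pure [e2, e1])) + q * (L (pure [e1, e3]) - L (pure [e3, e1])) +
        s * (L (pure [e2, e3]) - L (pure [e3, e2])))" for p q s f
  have span: "\<exists>p q s. Q p q s f" if "f \<in> F.span ?W" for f
    using that
  proof (induction rule: F.span_induct_alt)
    case base
    show ?case
      by (rule exI[of _ 0])+ (auto simp: Q_def linear_at_0)
  next
    case (step c t f)
    then obtain p q s where f: "Q p q s f" by blast
    obtain a b where t: "t = pure [a, b] - pure [b, a]" using step by blast
    obtain a1 a2 a3 where a: "a = scale a1 e1 + scale a2 e2 + scale a3 e3" using e by blast
    obtain b1 b2 b3 where b: "b = scale b1 e1 + scale b2 e2 + scale b3 e3" using e by blast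
    \<comment> \<open>The increments are \<open>c\<close> times the 2 by 2 minors of the coordinates
      of \<open>a\<close> and \<open>b\<close>; the diagonal terms \<open>pure [e1, e1]\<close> etc.
      cancel in \<open>t\<close>.\<close>
    have "Q (p + c * (a1 * b2 - a2 * b1)) (q + c * (a1 * b3 - a3 * b1)) (s + c * (a2 * b3 - a3 * b2))
        (formal_scale c t + f)"
      unfolding Q_def
    proof (intro allI impI)
      fix L :: "('a list \<Rightarrow>\<^sub>0 'k) \<Rightarrow> 'k"
      assume L: "Vector_Spaces.linear formal_scale (*) L"
        and G: "bilinear_form scale (\<lambda>a b. L (pure [a, b]))"
      interpret L: Vector_Spaces.linear formal_scale "(*)" L by fact
      have Lf: "L f = p * (L (pure [e1, e2]) - L (pure [e2, e1])) +
          q * (L (pure [e1, e3]) - L (pure [e3, e1])) + s * (L (pure [e2, e3]) - L (pure [e3, e2]))"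
        using f L G unfolding Q_def by blast
      show "L (formal_scale c t + f) =
          (p + c * (a1 * b2 - a2 * b1)) * (L (pure [e1, e2]) - L (pure [e2, e1])) +
          (q + c * (a1 * b3 - a3 * b1)) * (L (pure [e1, e3]) - L (pure [e3, e1])) +
          (s + c * (a2 * b3 - a3 * b2)) * (L (pure [e2, e3]) - L (pure [e3, e2]))"
        unfolding t a b L.add L.scale L.diff Lf bilinear_formD[OF G] by algebra
    qed
    then show ?case by blast
  qed
  obtain w where w: "w \<in> F.span ?W" "tensor scale 2 (\<Sum>i<n. pure [x i, y i]) = tensor scale 2 w"
    using mem unfolding wedge2_def by blast
  obtain p q s where Q: "Q p q s w" using span w(1) by blast
  obtain u v where uv: "\<And>G. bilinear_form scale G \<Longrightarrow>
      p * (G e1 e2 - G e2 e1) + q * (G e1 e3 - G e3 e1) + s * (G e2 e3 - G e3 e2) = G u v - G v u"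
    using wedge_decomposable by blast
  have "(\<Sum>i<n. G (x i) (y i)) = G u v - G v u" if G: "bilinear_form scale G" for G
  proof -
    obtain L where L: "Vector_Spaces.linear formal_scale (*) L"
      and pure: "\<And>a b. L (pure [a, b]) = G a b" and rel: "\<And>t. t \<in> tensor_relations scale 2 \<Longrightarrow> L t = 0"
      using bilinear_form_lift[OF G] by blast
    interpret L: Vector_Spaces.linear formal_scale "(*)" L by fact
    \<comment> \<open>Equal tensors differ by an element of the span of the relations, which
      \<open>L\<close> kills.\<close>
    have "L ((\<Sum>i<n. pure [x i, y i]) - w) = 0"
      by (rule L.eq_0_on_span[OF rel]) (use w(2) in \<open>simp_all only: tensor_eq_iff\<close>)
    then have "(\<Sum>i<n. G (x i) (y i)) = L w"
      by (simp add: L.diff L.sum pure)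
    with Q[unfolded Q_def, rule_format, OF L] G show ?thesis by (simp add: pure uv)
  qed
  then show ?thesis by (rule that)
qed

text \<open>With the other two pairs fixed, \<open>S\<close> replaces the sum over one index by a
  difference of values at (u, v) and (v, u). After three replacements only values covered by
  \<open>zero\<close> remain. The abstract \<open>Q\<close> serves all four terms of
  [[r,r,r]].\<close>

lemma triple_sum_eq_0:
  assumes S: "\<And>G. bilinear_form scale G \<Longrightarrow> (\<Sum>i<n. G (x i) (y i)) = G u v - G v u"
    and bil: "\<And>b b' c c'. bilinear_form scale (\<lambda>a a'. Q a a' b b' c c')"
      "\<And>a a' c c'. bilinear_form scale (\<lambda>b b'. Q a a' b b' c c')"
      "\<And>a a' b b'. bilinear_form scale (\<lambda>c c'. Q a a' b b' c c')"
    and zero: "\<And>a a' b b' c c'. {a, a', b, b', c, c'} \<subseteq> {u, v} \<Longrightarrow> Q a a' b b' c c' = 0"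
  shows "(\<Sum>i<n. \<Sum>j<n. \<Sum>k<n. Q (x i) (y i) (x j) (y j) (x k) (y k)) = 0"
  by (simp add: S[OF bil(1)] S[OF bil(2)] S[OF bil(3)] sum_subtractf zero)

section \<open>Vanishing of [[r,r,r]] for decomposable r\<close>

context three_lie_algebra
begin

text \<open>Pigeonhole: among three arguments from a set of at most two elements, two coincide;
  skew-symmetry moves them into the first two slots.\<close>

lemma bracket_in_pair_eq_0:
  assumes "{a, b, c} \<subseteq> {u, v}"
  shows "br a b c = 0"
proof -
  have "br p q p = 0" for p q
    using skew23[of p q p] alternating[of p q] by simp
  moreover from this have "br p q q = 0" for p q
    using skew12[of p q q] by simp
  ultimately show ?thesis
    using assms alternating by auto
qed

lemma linear_bracket_compose:
  assumes "Vector_Spaces.linear scale (*) f"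
  shows "Vector_Spaces.linear scale (*) (\<lambda>a. f (br a b c))"
    "Vector_Spaces.linear scale (*) (\<lambda>b. f (br a b c))"
    "Vector_Spaces.linear scale (*) (\<lambda>c. f (br a b c))"
  using Vector_Spaces.linear_compose[OF linear1 assms] Vector_Spaces.linear_compose[OF linear2 assms]
    Vector_Spaces.linear_compose[OF linear3 assms]
  by (simp_all add: o_def)

lemma yang_baxter_eq_0_if_decomposable:
  fixes x y :: "nat \<Rightarrow> 'a"
  assumes S: "\<And>G. bilinear_form scale G \<Longrightarrow> (\<Sum>i<n. G (x i) (y i)) = G u v - G v u"
  shows "tensor scale 4 (yang_baxter br n x y) = tensor scale 4 0"
proof -
  have "yang_baxter br n x y \<in> module.span formal_scale (tensor_relations scale 4)"
  proof (rule mem_span_if_functionals_vanish[OF vector_space_formal_scale])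
    fix L assume L: "Vector_Spaces.linear formal_scale (*) L"
      and rel: "\<And>t. t \<in> tensor_relations scale 4 \<Longrightarrow> L t = 0"
    interpret L: Vector_Spaces.linear formal_scale "(*)" L by fact
    note upd = linear_pure_update[where n = 4, OF vector_space_axioms L rel]
    have lin: "Vector_Spaces.linear scale (*) (\<lambda>a. L (pure [a, b, c, d]))"
      "Vector_Spaces.linear scale (*) (\<lambda>b. L (pure [a, b, c, d]))"
      "Vector_Spaces.linear scale (*) (\<lambda>c. L (pure [a, b, c, d]))"
      "Vector_Spaces.linear scale (*) (\<lambda>d. L (pure [a, b, c, d]))" for a b c d
      using upd[where xs = "[a, b, c, d]" and i = 0] upd[where xs = "[a, b, c, d]" and i = 1] upd[where xs = "[a, b, c, d]" and i = 2]
        upd[where xs = "[a, b, c, d]" and i = 3]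
      by (simp_all add: numeral_2_eq_2 numeral_3_eq_3)
    \<comment> \<open>A slot may hold a bracket; the form is then linear in each argument of that
      bracket.\<close>
    note lin' = lin lin[THEN linear_bracket_compose(1)] lin[THEN linear_bracket_compose(2)]
      lin[THEN linear_bracket_compose(3)]
    have zero: "L (pure [0, b, c, d]) = 0" "L (pure [a, 0, c, d]) = 0"
      "L (pure [a, b, 0, d]) = 0" "L (pure [a, b, c, 0]) = 0" for a b c d
      using lin[THEN linear_at_0] by blast+
    note triple = triple_sum_eq_0[where scale = scale and u = u and v = v and n = n, OF S]
    \<comment> \<open>The four terms differ in the position of the bracket, but each has one bracket
      argument from each pair (a, a'), (b, b'), (c, c') and the other member in a slot of its own,
      so \<open>Q\<close> is bilinear in every pair. On {u, v} the bracket is 0, and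
      \<open>L\<close> kills a pure tensor with a zero entry.\<close>
    have 1: "(\<Sum>i<n. \<Sum>j<n. \<Sum>k<n. L (pure [br (x i) (x j) (x k), y i, y j, y k])) = 0"
      by (rule triple[where Q = "\<lambda>a a' b b' c c'. L (pure [br a b c, a', b', c'])"])
        (auto simp: bilinear_form_def lin' bracket_in_pair_eq_0[of _ _ _ u v] zero)
    have 2: "(\<Sum>i<n. \<Sum>j<n. \<Sum>k<n. L (pure [x i, br (y i) (x j) (x k), y j, y k])) = 0"
      by (rule triple[where Q = "\<lambda>a a' b b' c c'. L (pure [a, br a' b c, b', c'])"])
        (auto simp: bilinear_form_def lin' bracket_in_pair_eq_0[of _ _ _ u v] zero)
    have 3: "(\<Sum>i<n. \<Sum>j<n. \<Sum>k<n. L (pure [x i, x j, br (y i) (y j) (x k), y k])) = 0"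
      by (rule triple[where Q = "\<lambda>a a' b b' c c'. L (pure [a, b, br a' b' c, c'])"])
        (auto simp: bilinear_form_def lin' bracket_in_pair_eq_0[of _ _ _ u v] zero)
    have 4: "(\<Sum>i<n. \<Sum>j<n. \<Sum>k<n. L (pure [x i, x j, x k, br (y i) (y j) (y k)])) = 0"
      by (rule triple[where Q = "\<lambda>a a' b b' c c'. L (pure [a, b, c, br a' b' c'])"])
        (auto simp: bilinear_form_def lin' bracket_in_pair_eq_0[of _ _ _ u v] zero)
    show "L (yang_baxter br n x y) = 0"
      by (simp add: yang_baxter_def L.sum L.add sum.distrib 1 2 3 4)
  qed
  then show ?thesis by (simp add: tensor_eq_iff)
qed

end

theorem theorem3p5:
  fixes scale :: "'k::field \<Rightarrow> 'a::ab_group_add \<Rightarrow> 'a"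
    and br :: "'a \<Rightarrow> 'a \<Rightarrow> 'a \<Rightarrow> 'a"
    and r :: "('a list \<Rightarrow>\<^sub>0 'k) set"
    and n :: nat and x y :: "nat \<Rightarrow> 'a"
  assumes "three_lie_algebra scale br"
    and "vector_space.dim scale (UNIV :: 'a set) = 3"
    and "r \<in> wedge2 scale"
    and "r = tensor scale 2 (\<Sum>i<n. pure [x i, y i])"
  shows "tensor scale 4 (yang_baxter br n x y) = tensor scale 4 0"
proof -
  interpret three_lie_algebra scale br by fact
  obtain u v where "\<And>G. bilinear_form scale G \<Longrightarrow> (\<Sum>i<n. G (x i) (y i)) = G u v - G v u"
    using wedge2_dim_3_decomposable[OF vector_space_axioms assms(2)] assms(3,4) by blast
  then show ?thesis by (rule yang_baxter_eq_0_if_decomposable)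
qed

end
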